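(* Let $k$ be a field, $R=k[x_1,x_2,x_3]$, $\mathfrak{m}=(x_1,x_2,x_3)$, and let $I\subset R$ be an $(n-1)$-balanced almost complete intersection ideal generated by forms of degree $n$ ($n\le 7$). Let $\mathbf{B}$ be the content matrix defined in the context. Then $\det\mathbf{B}\neq 0$.
   Context: Here $I=(a_1,a_2,a_3,a)$ is an $\mathfrak{m}$-primary ideal minimally generated by four forms of the same degree $n\ge 2$, with $J=(a_1,a_2,a_3)$ a minimal reduction of $I$ (i.e. $I^{q+1}=JI^q$ for some $q$). Let $\varphi$ be the matrix of syzygies of $I$ in a minimal graded free presentation and $I_1(\varphi)$ the ideal generated by its entries; $I$ is called $s$-balanced if $I_1(\varphi)=\mathfrak{m}^s$. Let $S=R[T_1,T_2,T_3,T_4]$ and let $L=\ker(S\to R[It])$ ($T_i\mapsto a_it$ for $i\le 3$, $T_4\mapsto at$); $L_i$, $S_i$ denote the components of degree $i$ in the $T$'s. When $I$ is $(n-1)$-balanced, the $k$-vector space of syzygies of the generators of $I$ with coefficients of degree $n-1$ has dimension $n$; let $\mathbf{f}_1,\ldots,\mathbf{f}_n\in L_1$ be the linear forms $\sum_j c_{ij}T_j$ corresponding to a basis of it. Also $L_2/S_1L_1$ is minimally generated, as an $R$-module, by the classes of $\binom{n}{2}$ forms $\mathbf{h}_1,\ldots,\mathbf{h}_{\binom n2}\in L_2$, quadratic in the $T$'s with $R$-coefficients that are forms of degree $n-1$; fix such forms. Writing $\mathfrak{m}^{n-1}$ for the row vector of all monomials of degree $n-1$ in $x_1,x_2,x_3$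 (of length $\binom{n+1}{2}$), the square matrix $\mathbf{B}$ with entries in $k[T_1,\ldots,T_4]$ is defined by $$[\mathbf{f}_1,\ldots,\mathbf{f}_n,\mathbf{h}_1,\ldots,\mathbf{h}_{\binom n2}]=\mathfrak{m}^{n-1}\cdot\mathbf{B}.$$ *)

theory Defs
  imports
    "HOL-Library.Poly_Mapping"
    "HOL-Library.Numeral_Type"
    "HOL-Library.Function_Algebras"
    "HOL-Computational_Algebra.Polynomial"
    "Jordan_Normal_Form.Determinant"
begin

text \<open>
  The type \<open>('x \<Rightarrow>\<^sub>0 nat) \<Rightarrow>\<^sub>0 'a\<close> is the polynomial ring over \<open>'a\<close> in the variables \<open>'x\<close>:
  the outer finitely supported map sends an exponent vector to its coefficient.
\<close>

type_synonym ('x, 'a) mpoly = "('x \<Rightarrow>\<^sub>0 nat) \<Rightarrow>\<^sub>0 'a"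

definition Const :: "'a::zero \<Rightarrow> ('x, 'a) mpoly"
  where "Const c = Poly_Mapping.single 0 c"

definition Var :: "'x \<Rightarrow> ('x, 'a::zero_neq_one) mpoly"
  where "Var i = Poly_Mapping.single (Poly_Mapping.single i 1) 1"

definition xmonom :: "('x \<Rightarrow>\<^sub>0 nat) \<Rightarrow> ('x, 'a::zero_neq_one) mpoly"
  where "xmonom \<alpha> = Poly_Mapping.single \<alpha> 1"

definition mdeg :: "('x::finite \<Rightarrow>\<^sub>0 nat) \<Rightarrow> nat"
  where "mdeg \<alpha> = (\<Sum>i\<in>UNIV. Poly_Mapping.lookup \<alpha> i)"

text \<open>The zero polynomial counts as a form of every degree.\<close>

definition form :: "nat \<Rightarrow> ('x::finite, 'a::zero) mpoly \<Rightarrow> bool"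
  where "form d p \<longleftrightarrow> (\<forall>\<alpha>\<in>Poly_Mapping.keys p. mdeg \<alpha> = d)"


text \<open>
  The rings \<open>R = k[x\<^sub>1,x\<^sub>2,x\<^sub>3]\<close>, \<open>S = R[T\<^sub>1,\<dots>,T\<^sub>4]\<close> and \<open>k[T\<^sub>1,\<dots>,T\<^sub>4]\<close>. The index types \<open>3\<close> and \<open>4\<close>
  have the elements \<open>0, 1, 2\<close> and \<open>0, 1, 2, 3\<close>, so that \<open>T\<^sub>4\<close> is \<open>Var 3\<close>.
\<close>

type_synonym 'k R = "(3, 'k) mpoly"
type_synonym 'k S = "(4, 'k R) mpoly"
type_synonym 'k kT = "(4, 'k) mpoly"


lemma Const_simps:
  "Const 0 = 0" "Const 1 = 1"
  "Const ((a::'a::comm_ring_1) + b) = Const a + Const b"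
  "Const (a * b) = Const a * Const b"
  by (simp_all add: Const_def single_add mult_single)

text \<open>
  Module structures: a ring over itself (submodules are ideals), the free \<open>R\<close>-module \<open>R\<^sup>4\<close> as
  functions on the index type, \<open>R\<^sup>4\<close> as a \<open>k\<close>-vector space, and \<open>S\<close> as an \<open>R\<close>-module.
\<close>

abbreviation is_ideal :: "'a::comm_ring_1 set \<Rightarrow> bool"
  where "is_ideal \<equiv> Modules.module.subspace (*)"

abbreviation ideal_span :: "'a::comm_ring_1 set \<Rightarrow> 'a set"
  where "ideal_span \<equiv> Modules.module.span (*)"

text \<open>
  Not an interpretation: that would add simplification rules which loop with associativity of \<open>*\<close>.
\<close>

lemma module_times: "Modules.module ((*) :: 'a::comm_ring_1 \<Rightarrow> 'a \<Rightarrow> 'a)"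
  by unfold_locales (auto simp: distrib_left distrib_right mult.assoc)

definition scaleF :: "'a::comm_ring_1 \<Rightarrow> ('i \<Rightarrow> 'a) \<Rightarrow> ('i \<Rightarrow> 'a)"
  where "scaleF r v = (\<lambda>i. r * v i)"

global_interpretation freemod: Modules.module scaleF
  by unfold_locales (simp_all add: scaleF_def fun_eq_iff distrib_left distrib_right mult.assoc)

definition scaleK :: "'k::field \<Rightarrow> ('i \<Rightarrow> ('x, 'k) mpoly) \<Rightarrow> ('i \<Rightarrow> ('x, 'k) mpoly)"
  where "scaleK c v = (\<lambda>i. Const c * v i)"

global_interpretation kvs: Vector_Spaces.vector_space scaleK
  by unfold_locales (simp_all add: scaleK_def fun_eq_iff distrib_left distrib_right mult.assoc Const_simps)

definition scaleC :: "'a::comm_ring_1 \<Rightarrow> ('x, 'a) mpoly \<Rightarrow> ('x, 'a) mpoly"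
  where "scaleC r F = Const r * F"

global_interpretation polymod: Modules.module scaleC
  by unfold_locales (simp_all add: scaleC_def distrib_left distrib_right mult.assoc Const_simps)


definition ideal_prod :: "'a::comm_ring_1 set \<Rightarrow> 'a set \<Rightarrow> 'a set"
  where "ideal_prod A B = ideal_span {a * b | a b. a \<in> A \<and> b \<in> B}"

primrec ideal_power :: "'a::comm_ring_1 set \<Rightarrow> nat \<Rightarrow> 'a set"
  where
    "ideal_power I 0 = UNIV"
  | "ideal_power I (Suc q) = ideal_prod I (ideal_power I q)"

definition radical :: "'a::comm_ring_1 set \<Rightarrow> 'a set"
  where "radical I = {a. \<exists>m. a ^ m \<in> I}"

definition primary_ideal :: "'a::comm_ring_1 set \<Rightarrow> bool"
  where "primary_ideal I \<longleftrightarrow> is_ideal I \<and> I \<noteq> UNIV \<and>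
    (\<forall>a b. a * b \<in> I \<longrightarrow> a \<in> I \<or> b \<in> radical I)"

definition irrelevant_ideal :: "('x, 'a::comm_ring_1) mpoly set"
  where "irrelevant_ideal = ideal_span (range Var)"

definition reduction :: "'a::comm_ring_1 set \<Rightarrow> 'a set \<Rightarrow> bool"
  where "reduction J I \<longleftrightarrow> is_ideal J \<and> is_ideal I \<and> J \<subseteq> I \<and>
    (\<exists>q. ideal_power I (q + 1) = ideal_prod J (ideal_power I q))"

definition minimal_reduction :: "'a::comm_ring_1 set \<Rightarrow> 'a set \<Rightarrow> bool"
  where "minimal_reduction J I \<longleftrightarrow> reduction J I \<and> (\<forall>K. reduction K I \<and> K \<subseteq> J \<longrightarrow> K = J)"

definition minimal_generators :: "('i \<Rightarrow> 'a::comm_ring_1) \<Rightarrow> 'a set \<Rightarrow> bool"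
  where "minimal_generators g I \<longleftrightarrow> ideal_span (range g) = I \<and>
    (\<forall>i. g i \<notin> ideal_span (g ` (UNIV - {i})))"


definition Syz :: "('i::finite \<Rightarrow> 'a::comm_ring_1) \<Rightarrow> ('i \<Rightarrow> 'a) set"
  where "Syz g = {c. (\<Sum>i\<in>UNIV. c i * g i) = 0}"

text \<open>
  A matrix is given by the list \<open>\<phi>\<close> of its columns. For minimal generators \<open>g\<close> that are forms of one
  common degree, \<open>\<phi>\<close> is the matrix of a minimal graded free presentation of \<open>(g)\<close> iff its columns
  minimally generate the syzygy module and are homogeneous; because the degrees of the \<open>g i\<close> agree,
  the latter means that all entries of a column are forms of the same degree.
\<close>

definition minimal_syzygy_matrix ::
    "('i::finite \<Rightarrow> ('x::finite, 'a::comm_ring_1) mpoly) \<Rightarrow> ('i \<Rightarrow> ('x, 'a) mpoly) list \<Rightarrow> bool"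
  where "minimal_syzygy_matrix g \<phi> \<longleftrightarrow>
    (\<forall>c\<in>set \<phi>. \<exists>d. \<forall>i. form d (c i)) \<and>
    freemod.span (set \<phi>) = Syz g \<and>
    distinct \<phi> \<and> (\<forall>c\<in>set \<phi>. c \<notin> freemod.span (set \<phi> - {c}))"

definition entry_ideal :: "('i \<Rightarrow> 'a::comm_ring_1) list \<Rightarrow> 'a set"
  where "entry_ideal \<phi> = ideal_span {c i | c i. c \<in> set \<phi>}"

text \<open>The ideal \<open>(g)\<close> is \<open>s\<close>-balanced, for minimal generators \<open>g\<close> of one common degree.\<close>

definition balanced :: "nat \<Rightarrow> ('i::finite \<Rightarrow> ('x::finite, 'a::comm_ring_1) mpoly) \<Rightarrow> bool"
  where "balanced s g \<longleftrightarrow>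
    (\<exists>\<phi>. minimal_syzygy_matrix g \<phi> \<and> entry_ideal \<phi> = ideal_power irrelevant_ideal s)"


text \<open>
  The \<open>R\<close>-algebra map \<open>S \<rightarrow> R[t]\<close>, \<open>T\<^sub>i \<mapsto> g\<^sub>i t\<close>. Its image is the Rees algebra, so it has the same
  kernel as the map onto the Rees algebra.
\<close>

definition rees_map :: "('i::finite \<Rightarrow> 'a::comm_ring_1) \<Rightarrow> ('i, 'a) mpoly \<Rightarrow> 'a poly"
  where "rees_map g F = (\<Sum>\<beta>\<in>Poly_Mapping.keys F.
    [:Poly_Mapping.lookup F \<beta>:] * (\<Prod>i\<in>UNIV. monom (g i) 1 ^ Poly_Mapping.lookup \<beta> i))"

definition rees_ideal :: "('i::finite \<Rightarrow> 'a::comm_ring_1) \<Rightarrow> ('i, 'a) mpoly set"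
  where "rees_ideal g = {F. rees_map g F = 0}"

definition graded_part :: "('x::finite, 'a::zero) mpoly set \<Rightarrow> nat \<Rightarrow> ('x, 'a) mpoly set"
  where "graded_part A d = {F \<in> A. form d F}"

text \<open>The \<open>R\<close>-submodule \<open>S\<^sub>1L\<^sub>1\<close> of \<open>L\<^sub>2\<close>.\<close>

definition S1L1 :: "('i::finite \<Rightarrow> 'a::comm_ring_1) \<Rightarrow> ('i, 'a) mpoly set"
  where "S1L1 g = polymod.span
    {s * l | s l. s \<in> graded_part UNIV 1 \<and> l \<in> graded_part (rees_ideal g) 1}"

text \<open>The classes of the members of \<open>hs\<close> minimally generate the \<open>R\<close>-module \<open>M / N\<close>, where \<open>N \<subseteq> M\<close>.\<close>

definition minimally_generates_quotient ::
    "('x, 'a::comm_ring_1) mpoly list \<Rightarrow> ('x, 'a) mpoly set \<Rightarrow> ('x, 'a) mpoly set \<Rightarrow> bool"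
  where "minimally_generates_quotient hs M N \<longleftrightarrow>
    polymod.span (set hs \<union> N) = M \<and>
    distinct hs \<and> (\<forall>h\<in>set hs. h \<notin> polymod.span ((set hs - {h}) \<union> N))"

definition is_kbasis :: "('i \<Rightarrow> ('x, 'k::field) mpoly) list \<Rightarrow> ('i \<Rightarrow> ('x, 'k) mpoly) set \<Rightarrow> bool"
  where "is_kbasis cs V \<longleftrightarrow> distinct cs \<and> kvs.independent (set cs) \<and> kvs.span (set cs) = V"

definition syzygy_form :: "('i::finite \<Rightarrow> 'a::comm_ring_1) \<Rightarrow> ('i, 'a) mpoly"
  where "syzygy_form c = (\<Sum>j\<in>UNIV. Const (c j) * Var j)"

definition row_matrix :: "'a list \<Rightarrow> 'a mat"
  where "row_matrix xs = mat 1 (length xs) (\<lambda>(i, j). xs ! j)"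

text \<open>
  \<open>[F\<^sub>1,\<dots>,F\<^sub>N] = \<mm>\<^sup>d \<cdot> B\<close> over \<open>S\<close>, where \<open>ms\<close> enumerates the exponent vectors of the row \<open>\<mm>\<^sup>d\<close> and
  \<open>Poly_Mapping.map Const\<close> is the inclusion of \<open>k[T]\<close> in \<open>S\<close>.
\<close>

definition is_content_matrix ::
    "nat \<Rightarrow> ('x::finite \<Rightarrow>\<^sub>0 nat) list \<Rightarrow> ('i, ('x, 'k::field) mpoly) mpoly list \<Rightarrow>
      ('i, 'k) mpoly mat \<Rightarrow> bool"
  where "is_content_matrix d ms Fs B \<longleftrightarrow>
    distinct ms \<and> set ms = {\<alpha>. mdeg \<alpha> = d} \<and>
    B \<in> carrier_mat (length ms) (length Fs) \<and>
    row_matrix Fs =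
      row_matrix (map (\<lambda>\<alpha>. Const (xmonom \<alpha>)) ms) * map_mat (Poly_Mapping.map Const) B"

end

theory Submission
  imports Defs
begin

text \<open>
  The matrix \<open>B\<close> stays nonsingular even when \<open>T\<close> is specialised to \<open>(0, 0, 0, 1)\<close>. There the columns
  become the coefficient vectors of \<open>n + (n choose 2)\<close> forms of degree \<open>n - 1\<close> in the three variables
  \<open>x\<^sub>i\<close>: the last coefficients of the \<open>n\<close> syzygies \<open>c\<close> with coefficients of degree \<open>n - 1\<close>, and the
  coefficients of \<open>T\<^sub>4\<^sup>2\<close> in the forms \<open>h\<close>. The space of forms of degree \<open>n - 1\<close> has exactly the
  dimension \<open>n + (n choose 2)\<close> (\<open>card_exponents_3\<close>), so \<open>B\<close> is square, and \<open>det B = 0\<close> yields a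
  nontrivial linear relation over \<open>k\<close> between these forms (\<open>content_matrix_kernel\<close>).

  Such a relation is impossible, because all syzygies of \<open>a = (g 0, g 1, g 2)\<close> are Koszul syzygies, i.e.
  of the form \<open>a \<times> w\<close> with the cross product of vectors of length three. Multiply every syzygy form by
  \<open>T\<^sub>4\<close>; with the coefficients of the relation, these products and the \<open>h\<close> add up to an element \<open>G\<close> of
  \<open>L\<^sub>2\<close> without the term \<open>T\<^sub>4\<^sup>2\<close>. Hence \<open>G = T\<^sub>1 A\<^sub>1 + T\<^sub>2 A\<^sub>2 + T\<^sub>3 A\<^sub>3\<close> with \<open>A\<^sub>i\<close> linear in \<open>T\<close>, and the values
  of the \<open>A\<^sub>i\<close> at \<open>g\<close> form a syzygy of \<open>a\<close>. Subtracting the corresponding Koszul terms from the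
  \<open>A\<^sub>i\<close> does not change \<open>G\<close> and moves the \<open>A\<^sub>i\<close> into \<open>L\<^sub>1\<close>, so \<open>G\<close> lies in \<open>S\<^sub>1L\<^sub>1\<close>
  (\<open>quadric_in_S1L1\<close>). As the \<open>h\<close> minimally generate \<open>L\<^sub>2\<close> modulo \<open>S\<^sub>1L\<^sub>1\<close>, none of them occurs in the
  relation. What remains is a combination of the \<open>c\<close> whose last entry vanishes, that is, a syzygy of
  \<open>a\<close> with coefficients of degree \<open>n - 1\<close>; the Koszul syzygies have coefficients of degree at least
  \<open>n\<close>, so it is zero (\<open>low_degree_syzygy_eq_0\<close>), contrary to the independence of the \<open>c\<close>.

  That the syzygies of \<open>a\<close> are Koszul is depth sensitivity of the Koszul complex: since \<open>J\<close> is a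
  reduction of an ideal with radical \<open>\<mm>\<close>, it contains powers \<open>x\<^sub>1\<^sup>N, x\<^sub>2\<^sup>N, x\<^sub>3\<^sup>N\<close>
  (\<open>Var_powers_in_reduction\<close>). They form a regular sequence, and an ideal with three generators that
  contains a regular sequence of length three has only Koszul syzygies (\<open>depth_sensitivity\<close>).
\<close>

section \<open>Index types and spans\<close>

lemma UNIV_3: "(UNIV :: 3 set) = {0, 1, 2}"
proof (rule card_subset_eq[symmetric])
  show "card {0, 1, 2 :: 3} = card (UNIV :: 3 set)" by simp
qed auto

lemma UNIV_4: "(UNIV :: 4 set) = {0, 1, 2, 3}"
proof (rule card_subset_eq[symmetric])
  show "card {0, 1, 2, 3 :: 4} = card (UNIV :: 4 set)" by simp
qed auto

lemma all_3: "(\<forall>i::3. P i) \<longleftrightarrow> P 0 \<and> P 1 \<and> P 2"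
  using UNIV_3 by (metis (full_types) UNIV_I insertE singletonD)

lemma numerals_mod_3: "3 = (0::3)" "4 = (1::3)" "5 = (2::3)" "6 = (0::3)"
  by simp_all

lemma sum_UNIV_3: "(\<Sum>i\<in>(UNIV::3 set). f i) = f 0 + f 1 + f 2"
proof -
  have "(\<Sum>i\<in>{0, 1, 2::3}. f i) = f 0 + f 1 + f 2" by (simp add: add.assoc)
  thus ?thesis by (simp only: UNIV_3)
qed

lemma sum_UNIV_4: "(\<Sum>i\<in>(UNIV::4 set). f i) = f 0 + f 1 + f 2 + f 3"
proof -
  have "(\<Sum>i\<in>{0, 1, 2, 3::4}. f i) = f 0 + f 1 + f 2 + f 3" by (simp add: add.assoc)
  thus ?thesis by (simp only: UNIV_4)
qed

text \<open>
  The form in which minimality of generators is used: it forbids relations with a unit coefficient.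
  The relation is only required to hold modulo \<open>span S\<close>, so the same lemma serves for generators of a
  quotient and for bases.
\<close>
lemma (in Modules.module) unit_coefficient_in_span:
  assumes "finite J" and "j0 \<in> J" and unit: "u * r j0 = 1"
    and total: "(\<Sum>j\<in>J. scale (r j) (x j)) \<in> span S"
    and others: "\<And>j. j \<in> J \<Longrightarrow> j \<noteq> j0 \<Longrightarrow> x j \<in> span S"
  shows "x j0 \<in> span S"
proof -
  have rest: "(\<Sum>j\<in>J - {j0}. scale (r j) (x j)) \<in> span S"
    by (intro span_sum span_scale others) auto
  have "scale (r j0) (x j0) \<in> span S"
    using span_diff[OF total rest] assms(1,2) by (simp add: sum.remove[of J j0])
  hence "scale u (scale (r j0) (x j0)) \<in> span S" by (rule span_scale)
  thus ?thesis by (simp add: unit)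
qed

section \<open>Monomials and forms\<close>

lemma mpoly_sum_singles:
  fixes p :: "('x, 'a::comm_monoid_add) mpoly"
  assumes "finite A" and "Poly_Mapping.keys p \<subseteq> A"
  shows "p = (\<Sum>\<beta>\<in>A. Poly_Mapping.single \<beta> (Poly_Mapping.lookup p \<beta>))"
proof (rule poly_mapping_eqI)
  fix \<gamma>
  show "Poly_Mapping.lookup p \<gamma> =
    Poly_Mapping.lookup (\<Sum>\<beta>\<in>A. Poly_Mapping.single \<beta> (Poly_Mapping.lookup p \<beta>)) \<gamma>"
    using assms by (auto simp: lookup_sum lookup_single when_def sum.delta in_keys_iff)
qed

lemma Var_power: "(Var i :: ('x, 'a::comm_semiring_1) mpoly) ^ N
    = Poly_Mapping.single (Poly_Mapping.single i N) 1"
proof (induction N)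
  case (Suc N)
  have "Poly_Mapping.single i (Suc 0) + Poly_Mapping.single i N = Poly_Mapping.single i (Suc N)"
    by (simp flip: single_add)
  with Suc show ?case by (simp add: Var_def mult_single)
qed simp

lemma lookup_mult_single:
  fixes p :: "('x, 'a::comm_semiring_1) mpoly"
  shows "Poly_Mapping.lookup (Poly_Mapping.single \<alpha> c * p) (\<alpha> + \<beta>) = c * Poly_Mapping.lookup p \<beta>"
proof -
  let ?A = "Poly_Mapping.keys p"
  have "Poly_Mapping.lookup (Poly_Mapping.single \<alpha> c * p) (\<alpha> + \<beta>) =
      Poly_Mapping.lookup
        (\<Sum>\<gamma>\<in>?A. Poly_Mapping.single (\<alpha> + \<gamma>) (c * Poly_Mapping.lookup p \<gamma>)) (\<alpha> + \<beta>)"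
    by (subst (1) mpoly_sum_singles[of ?A p]) (simp_all add: sum_distrib_left mult_single)
  also have "\<dots> = c * Poly_Mapping.lookup p \<beta>"
    by (auto simp: lookup_sum lookup_single when_def sum.delta in_keys_iff)
  finally show ?thesis .
qed

lemma split_exponent:
  assumes "N \<le> Poly_Mapping.lookup \<beta> i"
  shows "\<beta> = Poly_Mapping.single i N + (\<beta> - Poly_Mapping.single i (N::nat))"
  by (rule poly_mapping_eqI) (use assms in \<open>auto simp: lookup_add lookup_minus lookup_single when_def\<close>)

lemma mdeg_simps [simp]:
  "mdeg (\<alpha> + \<beta>) = mdeg \<alpha> + mdeg \<beta>" "mdeg (Poly_Mapping.single i N) = N" "mdeg 0 = 0"
  by (simp_all add: mdeg_def lookup_add sum.distrib lookup_single when_def)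

lemma mdeg_eq_0_iff: "mdeg \<alpha> = 0 \<longleftrightarrow> \<alpha> = 0"
  by (auto simp: mdeg_def intro!: poly_mapping_eqI)

lemma form_0 [simp]: "form d 0"
  by (simp add: form_def)

lemma form_add: "form d p \<Longrightarrow> form d q \<Longrightarrow> form d (p + q)"
  unfolding form_def using keys_add[of p q] by blast

lemma form_uminus: "form d p \<Longrightarrow> form d (- p :: ('x::finite, 'a::ab_group_add) mpoly)"
  by (simp add: form_def)

lemma form_diff: "form d p \<Longrightarrow> form d q \<Longrightarrow> form d (p - q :: ('x::finite, 'a::ab_group_add) mpoly)"
  using form_add[OF _ form_uminus, of d p q] by simp

lemma form_sum: "(\<And>i. i \<in> A \<Longrightarrow> form d (f i)) \<Longrightarrow> form d (sum f A)"
  by (induction A rule: infinite_finite_induct) (auto intro: form_add)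

lemma form_mult: "form d p \<Longrightarrow> form e q \<Longrightarrow> form (d + e) (p * q)"
  unfolding form_def using keys_mult[of p q] by force

lemma form_single: "mdeg \<beta> = d \<Longrightarrow> form d (Poly_Mapping.single \<beta> c)"
  by (simp add: form_def)

lemma form_Const: "form 0 (Const c)"
  by (simp add: Const_def form_single)

lemma form_Var: "form 1 (Var i)"
  by (simp add: Var_def form_single)

lemma form_0_eq_Const:
  fixes p :: "('x::finite, 'a::comm_monoid_add) mpoly"
  assumes "form 0 p" shows "p = Const (Poly_Mapping.lookup p 0)"
  using mpoly_sum_singles[of "{0}" p] assms
  by (auto simp: form_def mdeg_eq_0_iff Const_def)

text \<open>
  Every monomial of positive degree is divisible by some variable; distribute the terms according to
  a choice of such a variable.
\<close>
lemma form_Suc_decomp: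
  fixes p :: "('x::finite, 'a::comm_semiring_1) mpoly"
  assumes "form (Suc d) p"
  obtains A where "\<And>i. form d (A i)" and "p = (\<Sum>i\<in>UNIV. Var i * A i)"
proof -
  let ?K = "Poly_Mapping.keys p"
  have "\<exists>i. 1 \<le> Poly_Mapping.lookup \<beta> i" if "\<beta> \<in> ?K" for \<beta>
  proof (rule ccontr)
    assume "\<not> ?thesis"
    hence "\<beta> = 0" by (auto intro!: poly_mapping_eqI simp: not_le)
    with that assms show False by (auto simp: form_def)
  qed
  then obtain v where v: "\<And>\<beta>. \<beta> \<in> ?K \<Longrightarrow> 1 \<le> Poly_Mapping.lookup \<beta> (v \<beta>)" by metis
  define r where "r \<beta> = \<beta> - Poly_Mapping.single (v \<beta>) 1" for \<beta> :: "'x \<Rightarrow>\<^sub>0 nat"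
  have r: "\<beta> = Poly_Mapping.single (v \<beta>) 1 + r \<beta>" if "\<beta> \<in> ?K" for \<beta>
    unfolding r_def using split_exponent[OF v[OF that]] .
  define A where
    "A i = (\<Sum>\<beta>\<in>{\<beta>\<in>?K. v \<beta> = i}. Poly_Mapping.single (r \<beta>) (Poly_Mapping.lookup p \<beta>))" for i
  have "mdeg (r \<beta>) = d" if "\<beta> \<in> ?K" for \<beta>
    using arg_cong[OF r[OF that], of mdeg] assms that by (auto simp: form_def)
  hence "form d (A i)" for i
    unfolding A_def by (auto intro!: form_sum form_single)
  moreover have "p = (\<Sum>i\<in>UNIV. Var i * A i)"
  proof -
    have "p = (\<Sum>\<beta>\<in>?K. Poly_Mapping.single \<beta> (Poly_Mapping.lookup p \<beta>))"
      by (rule mpoly_sum_singles) auto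
    also have "\<dots> = (\<Sum>\<beta>\<in>?K. Var (v \<beta>) * Poly_Mapping.single (r \<beta>) (Poly_Mapping.lookup p \<beta>))"
      by (rule sum.cong) (use r in \<open>auto simp: Var_def mult_single\<close>)
    also have "\<dots> = (\<Sum>i\<in>UNIV. \<Sum>\<beta>\<in>{\<beta>\<in>?K. v \<beta> = i}.
        Var (v \<beta>) * Poly_Mapping.single (r \<beta>) (Poly_Mapping.lookup p \<beta>))"
      by (rule sum.group[symmetric]) auto
    also have "\<dots> = (\<Sum>i\<in>UNIV. Var i * A i)"
      unfolding A_def sum_distrib_left by (intro sum.cong refl) auto
    finally show ?thesis .
  qed
  ultimately show ?thesis by (rule that)
qed

lemma form_1_eq_syzygy_form:
  fixes p :: "('x::finite, 'a::comm_ring_1) mpoly"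
  assumes "form 1 p" obtains c where "p = syzygy_form c"
proof -
  obtain A where A: "\<And>i. form 0 (A i)" and p: "p = (\<Sum>i\<in>UNIV. Var i * A i)"
    using form_Suc_decomp[of 0 p] assms by auto
  have "p = syzygy_form (\<lambda>i. Poly_Mapping.lookup (A i) 0)"
    unfolding p syzygy_form_def
    by (rule sum.cong[OF refl]) (metis form_0_eq_Const[OF A] mult.commute)
  thus ?thesis by (rule that)
qed

text \<open>
  For \<open>d = n - 1\<close> this number is \<open>n + (n choose 2)\<close>, the number of columns of the content matrix.
\<close>
lemma card_exponents_3: "card {\<alpha> :: 3 \<Rightarrow>\<^sub>0 nat. mdeg \<alpha> = d} = (d + 2) choose 2"
proof -
  let ?l = "Poly_Mapping.lookup :: (3 \<Rightarrow>\<^sub>0 nat) \<Rightarrow> 3 \<Rightarrow> nat"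
  \<comment> \<open>An exponent vector is coded by the sum \<open>s\<close> of its first two entries and by its second entry \<open>b\<close>.\<close>
  let ?e = "\<lambda>(s, b). Poly_Mapping.single 0 (s - b) + Poly_Mapping.single 1 b +
    Poly_Mapping.single (2::3) (d - s) :: 3 \<Rightarrow>\<^sub>0 nat"
  let ?c = "\<lambda>\<alpha>. (?l \<alpha> 0 + ?l \<alpha> 1, ?l \<alpha> 1)"
  have mdeg3: "mdeg \<alpha> = ?l \<alpha> 0 + ?l \<alpha> 1 + ?l \<alpha> 2" for \<alpha>
    by (simp add: mdeg_def sum_UNIV_3)
  have "bij_betw ?e (SIGMA s:{..d}. {..s}) {\<alpha>. mdeg \<alpha> = d}"
  proof (rule bij_betw_byWitness[where f' = ?c])
    show "\<forall>\<alpha>\<in>{\<alpha>. mdeg \<alpha> = d}. ?e (?c \<alpha>) = \<alpha>"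
    proof
      fix \<alpha> :: "3 \<Rightarrow>\<^sub>0 nat" assume "\<alpha> \<in> {\<alpha>. mdeg \<alpha> = d}"
      hence d: "d = ?l \<alpha> 0 + ?l \<alpha> 1 + ?l \<alpha> 2"
        using mdeg3 by simp
      have "\<forall>i. ?l (?e (?c \<alpha>)) i = ?l \<alpha> i"
        unfolding all_3 d by (simp add: lookup_add lookup_single when_def)
      thus "?e (?c \<alpha>) = \<alpha>"
        by (intro poly_mapping_eqI) (rule spec)
    qed
  qed (auto simp: mdeg3 lookup_add lookup_single when_def)
  hence "card {\<alpha> :: 3 \<Rightarrow>\<^sub>0 nat. mdeg \<alpha> = d} = card (SIGMA s:{..d}. {..s})"
    by (rule bij_betw_same_card[symmetric])
  also have "\<dots> = (\<Sum>s\<le>d. Suc s)" by simp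
  also have "\<dots> = (d + 2) choose 2"
    by (induction d) (simp_all add: numeral_2_eq_2)
  finally show ?thesis .
qed

section \<open>Evaluation of polynomials\<close>

definition mpoly_eval ::
    "('a::comm_ring_1 \<Rightarrow> 'b::comm_ring_1) \<Rightarrow> ('x::finite \<Rightarrow> 'b) \<Rightarrow> ('x, 'a) mpoly \<Rightarrow> 'b"
  where "mpoly_eval \<phi> x p = (\<Sum>\<beta>\<in>Poly_Mapping.keys p.
    \<phi> (Poly_Mapping.lookup p \<beta>) * (\<Prod>i\<in>UNIV. x i ^ Poly_Mapping.lookup \<beta> i))"

text \<open>
  The Rees map and the specialisation of \<open>T\<close> are both evaluations, so the homomorphism properties
  are established for evaluations in general.
\<close>
lemma rees_map_eq_eval: "rees_map g = mpoly_eval (\<lambda>c. [:c:]) (\<lambda>i. monom (g i) 1)"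
  by (simp add: fun_eq_iff rees_map_def mpoly_eval_def)

context comm_ring_hom
begin

lemma mpoly_eval_superset:
  assumes "finite A" and "Poly_Mapping.keys p \<subseteq> A"
  shows "mpoly_eval hom x p =
    (\<Sum>\<beta>\<in>A. hom (Poly_Mapping.lookup p \<beta>) * (\<Prod>i\<in>UNIV. x i ^ Poly_Mapping.lookup \<beta> i))"
  unfolding mpoly_eval_def using assms
  by (intro sum.mono_neutral_left) (auto simp: in_keys_iff)

lemma mpoly_eval_single:
  "mpoly_eval hom x (Poly_Mapping.single \<beta> c) = hom c * (\<Prod>i\<in>UNIV. x i ^ Poly_Mapping.lookup \<beta> i)"
  by (subst mpoly_eval_superset[of "{\<beta>}"]) auto

lemma mpoly_eval_add: "mpoly_eval hom x (p + q) = mpoly_eval hom x p + mpoly_eval hom x q"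
proof -
  let ?A = "Poly_Mapping.keys p \<union> Poly_Mapping.keys q"
  have "Poly_Mapping.keys (p + q) \<subseteq> ?A" by (rule keys_add)
  thus ?thesis
    by (simp add: mpoly_eval_superset[of ?A] lookup_add hom_add distrib_right sum.distrib)
qed

lemma mpoly_eval_sum: "mpoly_eval hom x (sum f A) = (\<Sum>i\<in>A. mpoly_eval hom x (f i))"
  by (induction A rule: infinite_finite_induct) (auto simp: mpoly_eval_add, auto simp: mpoly_eval_def)

lemma mpoly_eval_mult: "mpoly_eval hom x (p * q) = mpoly_eval hom x p * mpoly_eval hom x q"
proof -
  let ?P = "Poly_Mapping.keys p" and ?Q = "Poly_Mapping.keys q"
  let ?s = "\<lambda>p \<beta>. Poly_Mapping.single \<beta> (Poly_Mapping.lookup p \<beta>)"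
  have pq: "p = sum (?s p) ?P" "q = sum (?s q) ?Q"
    by (rule mpoly_sum_singles; simp)+
  have "mpoly_eval hom x (?s p \<alpha> * ?s q \<beta>) = mpoly_eval hom x (?s p \<alpha>) * mpoly_eval hom x (?s q \<beta>)"
    for \<alpha> \<beta>
    by (simp add: mult_single mpoly_eval_single hom_mult lookup_add power_add prod.distrib mult_ac)
  hence "mpoly_eval hom x (sum (?s p) ?P * sum (?s q) ?Q) =
      mpoly_eval hom x (sum (?s p) ?P) * mpoly_eval hom x (sum (?s q) ?Q)"
    by (simp add: sum_product mpoly_eval_sum)
  thus ?thesis by (simp flip: pq)
qed

lemma comm_ring_hom_mpoly_eval: "comm_ring_hom (mpoly_eval hom x)"
proof
  show "mpoly_eval hom x 0 = 0" by (simp add: mpoly_eval_def)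
  show "mpoly_eval hom x 1 = 1" using mpoly_eval_single[of x 0 1] by simp
qed (rule mpoly_eval_add mpoly_eval_mult)+

lemma mpoly_eval_Const: "mpoly_eval hom x (Const c) = hom c"
  by (simp add: Const_def mpoly_eval_single)

lemma mpoly_eval_Var: "mpoly_eval hom x (Var i) = x i"
proof -
  have "(\<Prod>j\<in>UNIV. x j ^ Poly_Mapping.lookup (Poly_Mapping.single i 1) j) =
      (\<Prod>j\<in>UNIV. if j = i then x i else 1)"
    by (rule prod.cong) (auto simp: lookup_single when_def)
  thus ?thesis by (simp add: Var_def mpoly_eval_single)
qed

lemma mpoly_eval_syzygy_form: "mpoly_eval hom x (syzygy_form c) = (\<Sum>j\<in>UNIV. hom (c j) * x j)"
  by (simp add: syzygy_form_def mpoly_eval_sum mpoly_eval_mult mpoly_eval_Const mpoly_eval_Var)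

text \<open>
  Evaluation commutes with a change of coefficients. For \<open>hom = Const\<close> this compares specialising the
  entries of the content matrix with specialising the same entries regarded as elements of \<open>S\<close>.
\<close>
lemma hom_mpoly_eval:
  "hom (mpoly_eval id x p) = mpoly_eval id (\<lambda>i. hom (x i)) (Poly_Mapping.map hom p)"
proof -
  interpret id: comm_ring_hom "id :: 'b \<Rightarrow> 'b" by unfold_locales auto
  have "Poly_Mapping.keys (Poly_Mapping.map hom p) \<subseteq> Poly_Mapping.keys p"
    by (auto simp: in_keys_iff map.rep_eq when_def)
  thus ?thesis
    by (subst id.mpoly_eval_superset[of "Poly_Mapping.keys p"])
      (auto simp: mpoly_eval_def hom_sum hom_mult hom_prod hom_power map.rep_eq when_def in_keys_iff
        intro!: sum.cong)
qed

end

lemma comm_ring_hom_Const: "comm_ring_hom (Const :: 'a::comm_ring_1 \<Rightarrow> ('x, 'a) mpoly)"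
  by unfold_locales (simp_all add: Const_simps)

lemma comm_ring_hom_const_poly: "comm_ring_hom (\<lambda>c::'a::comm_ring_1. [:c:])"
  by unfold_locales (simp_all add: one_pCons)

lemma comm_ring_hom_id: "comm_ring_hom (id :: 'a::comm_ring_1 \<Rightarrow> 'a)"
  by unfold_locales auto

section \<open>Powers of the variables form a regular sequence\<close>

lemmas ideal_span_base = module.span_base[OF module_times]
  and ideal_span_sum = module.span_sum[OF module_times]
  and ideal_span_scale = module.span_scale[OF module_times]
  and ideal_span_minimal = module.span_minimal[OF module_times]

lemma ideal_span_insert: "p \<in> ideal_span (insert a S) \<longleftrightarrow> (\<exists>c. p - c * a \<in> ideal_span S)"
  by (rule module.span_breakdown_eq[OF module_times])

lemma ideal_span_empty: "ideal_span {} = {0}"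
  by (rule module.span_empty[OF module_times])

text \<open>
  A monomial ideal consists of the polynomials all of whose monomials it contains. Membership
  becomes a condition on exponents, from which regularity can be read off.
\<close>
lemma power_ideal_iff:
  fixes p :: "('x, 'a::comm_ring_1) mpoly"
  shows "p \<in> ideal_span ((\<lambda>i. Var i ^ N) ` A) \<longleftrightarrow>
    (\<forall>\<beta>\<in>Poly_Mapping.keys p. \<exists>i\<in>A. N \<le> Poly_Mapping.lookup \<beta> i)" (is "?L \<longleftrightarrow> ?R")
proof
  let ?M = "{p :: ('x, 'a) mpoly. \<forall>\<beta>\<in>Poly_Mapping.keys p. \<exists>i\<in>A. N \<le> Poly_Mapping.lookup \<beta> i}"
  have "is_ideal ?M"
  proof (rule module.subspaceI[OF module_times])
    fix p q assume "p \<in> ?M" "q \<in> ?M"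
    thus "p + q \<in> ?M" using keys_add[of p q] by blast
  next
    fix c p assume "p \<in> ?M"
    thus "c * p \<in> ?M" using keys_mult[of c p] by (force simp: lookup_add intro: trans_le_add2)
  qed simp
  moreover have "(\<lambda>i. Var i ^ N) ` A \<subseteq> ?M"
    by (auto simp: Var_power intro!: bexI)
  ultimately have "ideal_span ((\<lambda>i. Var i ^ N) ` A) \<subseteq> ?M"
    by (rule ideal_span_minimal[rotated])
  thus "?L \<Longrightarrow> ?R" by auto
next
  assume R: ?R
  let ?s = "\<lambda>\<beta>. Poly_Mapping.single \<beta> (Poly_Mapping.lookup p \<beta>)"
  have "?s \<beta> \<in> ideal_span ((\<lambda>i. Var i ^ N) ` A)" if "\<beta> \<in> Poly_Mapping.keys p" for \<beta>
  proof -
    from R that obtain i where i: "i \<in> A" "N \<le> Poly_Mapping.lookup \<beta> i" by blast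
    have "?s \<beta> =
        Poly_Mapping.single (\<beta> - Poly_Mapping.single i N) (Poly_Mapping.lookup p \<beta>) * Var i ^ N"
      using split_exponent[OF i(2)] by (simp add: Var_power mult_single add.commute)
    thus ?thesis using i(1) by (simp only:) (intro ideal_span_scale ideal_span_base imageI)
  qed
  hence "sum ?s (Poly_Mapping.keys p) \<in> ideal_span ((\<lambda>i. Var i ^ N) ` A)"
    by (rule ideal_span_sum)
  thus ?L using mpoly_sum_singles[of "Poly_Mapping.keys p" p] by simp
qed

text \<open>
  A factor \<open>x\<^sub>k\<^sup>N\<close> changes only the \<open>k\<close>-th exponent, which the condition for membership does not
  involve when \<open>k \<notin> A\<close>.
\<close>
lemma Var_power_regular:
  fixes u :: "('x, 'a::comm_ring_1) mpoly"
  assumes "k \<notin> A" and "Var k ^ N * u \<in> ideal_span ((\<lambda>i. Var i ^ N) ` A)"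
  shows "u \<in> ideal_span ((\<lambda>i. Var i ^ N) ` A)"
  unfolding power_ideal_iff
proof
  fix \<beta> assume "\<beta> \<in> Poly_Mapping.keys u"
  hence "Poly_Mapping.single k N + \<beta> \<in> Poly_Mapping.keys (Var k ^ N * u)"
    by (simp add: in_keys_iff Var_power lookup_mult_single)
  then obtain i where "i \<in> A" "N \<le> Poly_Mapping.lookup (Poly_Mapping.single k N + \<beta>) i"
    using assms(2) unfolding power_ideal_iff by blast
  thus "\<exists>i\<in>A. N \<le> Poly_Mapping.lookup \<beta> i"
    using assms(1)
    by (intro bexI[of _ i]) (auto simp: lookup_add lookup_single when_def split: if_splits)
qed

section \<open>Koszul syzygies of three elements\<close>

text \<open>
  With \<open>dot\<close> and \<open>cross\<close> the Koszul complex of three elements \<open>a\<close> reads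
  \<open>0 \<rightarrow> A \<rightarrow> A\<^sup>3 \<rightarrow> A\<^sup>3 \<rightarrow> A\<close>, where the maps are \<open>u \<mapsto> u a\<close>, \<open>w \<mapsto> a \<times> w\<close> and \<open>z \<mapsto> a \<cdot> z\<close>.
\<close>
definition dot :: "(3 \<Rightarrow> 'a::comm_ring_1) \<Rightarrow> (3 \<Rightarrow> 'a) \<Rightarrow> 'a"
  where "dot a z = a 0 * z 0 + a 1 * z 1 + a 2 * z 2"

definition cross :: "(3 \<Rightarrow> 'a::comm_ring_1) \<Rightarrow> (3 \<Rightarrow> 'a) \<Rightarrow> 3 \<Rightarrow> 'a"
  where "cross a w i = a (i + 1) * w (i + 2) - a (i + 2) * w (i + 1)"

text \<open>
  Consequently every element \<open>b = c \<cdot> a\<close> of the ideal generated by \<open>a\<close> annihilates the homology of the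
  Koszul complex: if \<open>a \<cdot> z = 0\<close>, then \<open>b z = a \<times> (z \<times> c)\<close>, and if \<open>a \<times> w = 0\<close>, then \<open>b w\<close> is a
  multiple of \<open>a\<close>.
\<close>
lemma cross_cross: "cross a (cross z c) i = dot c a * z i - dot a z * c i"
proof -
  have "\<forall>i. cross a (cross z c) i = dot c a * z i - dot a z * c i"
    unfolding all_3 by (simp add: cross_def dot_def numerals_mod_3 algebra_simps)
  thus ?thesis by blast
qed

lemma cross_lincomb:
  "cross a (\<lambda>i. p * v i - q * w i) i = p * cross a v i - q * cross a w i"
  by (simp add: cross_def algebra_simps)

lemma cross_self: "cross a a i = 0"
  by (simp add: cross_def algebra_simps)

lemma dot_cross_self: "dot a (cross a w) = 0"
  by (simp add: cross_def dot_def numerals_mod_3 algebra_simps)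

lemma ideal_span_range_dot:
  fixes a :: "3 \<Rightarrow> 'a::comm_ring_1"
  assumes "b \<in> ideal_span (range a)" obtains c where "b = dot c a"
proof -
  have "range a = {a 0, a 1, a 2}" by (simp add: UNIV_3)
  with assms obtain r s t where "b - r * a 0 - s * a 1 - t * a 2 = 0"
    by (auto simp: ideal_span_insert ideal_span_empty)
  hence "b = dot (\<lambda>i. if i = 0 then r else if i = 1 then s else t) a"
    by (simp add: dot_def algebra_simps)
  thus ?thesis by (rule that)
qed

text \<open>
  The elements \<open>b\<^sub>i\<close> annihilate the homology of the Koszul complex of \<open>a\<close>. Using that \<open>b\<^sub>0\<close> is regular,
  that \<open>b\<^sub>0, b\<^sub>1\<close> is a regular sequence, and finally that \<open>b\<^sub>0, b\<^sub>1, b\<^sub>2\<close> is one, the homology vanishes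
  successively in degrees 3, 2 and 1. In the last two degrees, choose preimages \<open>w\<^sub>i\<close> of the multiples
  \<open>b\<^sub>i z\<close> of a cycle \<open>z\<close>. The differences \<open>b\<^sub>j w\<^sub>i - b\<^sub>i w\<^sub>j\<close> are cycles one degree higher, hence boundaries,
  and regularity allows \<open>w\<^sub>0\<close> to be corrected by a boundary so that \<open>b\<^sub>0\<close> divides it and can be
  cancelled.
\<close>
lemma depth_sensitivity:
  fixes a b z :: "3 \<Rightarrow> 'a::comm_ring_1"
  assumes b: "\<And>i. b i \<in> ideal_span (range a)"
    and reg0: "\<And>u. b 0 * u = 0 \<Longrightarrow> u = 0"
    and reg1: "\<And>u. b 1 * u \<in> ideal_span {b 0} \<Longrightarrow> u \<in> ideal_span {b 0}"
    and reg2: "\<And>u. b 2 * u \<in> ideal_span {b 0, b 1} \<Longrightarrow> u \<in> ideal_span {b 0, b 1}"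
    and z: "dot a z = 0"
  obtains w where "z = cross a w"
proof -
  have reg1': "\<exists>v. u = b 0 * v" if "b 1 * u = b 0 * v" for u v
    using reg1[of u] that by (auto simp: ideal_span_insert ideal_span_empty mult.commute)
  have reg2': "\<exists>p q. u = p * b 0 + q * b 1" if "b 2 * u = p * b 0 + q * b 1" for u p q
  proof -
    have "b 2 * u - p * b 0 - q * b 1 = 0" using that by simp
    hence "b 2 * u \<in> ideal_span {b 0, b 1}"
      unfolding ideal_span_insert ideal_span_empty by blast
    from reg2[OF this] obtain p q where "u - p * b 0 - q * b 1 = 0"
      unfolding ideal_span_insert ideal_span_empty by blast
    thus ?thesis by (metis add.commute diff_diff_eq right_minus_eq)
  qed
  have "\<exists>c. b i = dot c a" for i using ideal_span_range_dot[OF b] by blast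
  then obtain c where c: "\<And>i. b i = dot (c i) a" by metis
  have bz: "b i * y j = cross a (cross y (c i)) j" if "dot a y = 0" for y i j
    using that by (simp add: cross_cross c)
  \<comment> \<open>Exactness in degree 3.\<close>
  have H3: "u = 0" if "\<And>j. u * a j = 0" for u
  proof (rule reg0)
    have "b 0 * u = c 0 0 * (u * a 0) + c 0 1 * (u * a 1) + c 0 2 * (u * a 2)"
      by (simp add: c dot_def algebra_simps)
    thus "b 0 * u = 0" by (simp add: that)
  qed
  \<comment> \<open>Exactness in degree 2: \<open>b\<^sub>0 w\<close> and \<open>b\<^sub>1 w\<close> are multiples of \<open>a\<close>; compare the two factors.\<close>
  have H2: "\<exists>u. w = (\<lambda>j. u * a j)" if w: "\<And>j. cross a w j = 0" for w
  proof -
    define e where "e i = dot w (c i)" for i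
    have e: "b i * w j = e i * a j" for i j
    proof -
      have "cross a w = (\<lambda>_. 0)" using w by (rule ext)
      moreover have "cross (c i) (cross a w) j = b i * - w j + e i * a j"
        using cross_cross[of "c i" a w j] by (simp add: c e_def dot_def algebra_simps)
      ultimately show ?thesis by (simp add: cross_def)
    qed
    have "b 1 * e 0 - b 0 * e 1 = 0"
    proof (rule H3)
      fix j
      have "(b 1 * e 0 - b 0 * e 1) * a j = b 1 * (b 0 * w j) - b 0 * (b 1 * w j)"
        unfolding e by (simp add: algebra_simps)
      thus "(b 1 * e 0 - b 0 * e 1) * a j = 0" by (simp add: algebra_simps)
    qed
    then obtain u where u: "e 0 = b 0 * u" using reg1'[of "e 0" "e 1"] by auto
    have "w j = u * a j" for j
    proof -
      have "b 0 * (w j - u * a j) = 0" using e[of 0 j] u by (simp add: algebra_simps)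
      from reg0[OF this] show ?thesis by simp
    qed
    thus ?thesis by blast
  qed
  \<comment> \<open>In degree 1, \<open>w i\<close> is a preimage of \<open>b\<^sub>i z\<close>.\<close>
  define w where "w i = cross z (c i)" for i
  have w: "cross a (w i) j = b i * z j" for i j using bz[OF z] by (simp add: w_def)
  have "\<exists>u. (\<lambda>m. b j * w i m - b i * w j m) = (\<lambda>m. u * a m)" for i j
    by (rule H2) (simp add: cross_lincomb w algebra_simps)
  hence ex_u: "\<exists>u. \<forall>m. b j * w i m - b i * w j m = u * a m" for i j
    by (simp add: fun_eq_iff)
  define u where "u i j = (SOME u. \<forall>m. b j * w i m - b i * w j m = u * a m)" for i j
  have u: "b j * w i m - b i * w j m = u i j * a m" for i j m
    unfolding u_def by (rule someI_ex[OF ex_u, THEN spec])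
  \<comment> \<open>The cocycle condition for \<open>u\<close> puts \<open>u 0 1\<close> into the ideal of \<open>b\<^sub>0\<close> and \<open>b\<^sub>1\<close>.\<close>
  have "b 2 * u 0 1 - b 1 * u 0 2 + b 0 * u 1 2 = 0"
  proof (rule H3)
    fix m
    have "(b 2 * u 0 1 - b 1 * u 0 2 + b 0 * u 1 2) * a m =
        b 2 * (u 0 1 * a m) - b 1 * (u 0 2 * a m) + b 0 * (u 1 2 * a m)"
      by (simp add: algebra_simps)
    also have "\<dots> = 0" unfolding u[symmetric] by (simp add: algebra_simps)
    finally show "(b 2 * u 0 1 - b 1 * u 0 2 + b 0 * u 1 2) * a m = 0" .
  qed
  hence "b 2 * u 0 1 = (- u 1 2) * b 0 + u 0 2 * b 1" by (simp add: algebra_simps add_eq_0_iff)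
  then obtain p q where pq: "u 0 1 = p * b 0 + q * b 1" using reg2' by blast
  \<comment> \<open>Subtracting \<open>q a\<close>, which \<open>a \<times> _\<close> kills, makes the preimage of \<open>b\<^sub>0 z\<close> divisible by \<open>b\<^sub>0\<close>.\<close>
  have "\<exists>v. w 0 m - q * a m = b 0 * v" for m
  proof (rule reg1')
    show "b 1 * (w 0 m - q * a m) = b 0 * (w 1 m + p * a m)"
      using u[of 1 0 m] pq by (simp add: algebra_simps)
  qed
  then obtain y where y: "\<And>m. w 0 m - q * a m = b 0 * y m" by metis
  have "z j = cross a y j" for j
  proof -
    have "b 0 * cross a y j = cross a (\<lambda>m. 1 * w 0 m - q * a m) j"
      unfolding cross_def mult_1 y by (simp add: algebra_simps)
    also have "\<dots> = b 0 * z j"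
      unfolding cross_lincomb by (simp add: cross_self w)
    finally have "b 0 * (z j - cross a y j) = 0" by (simp add: algebra_simps)
    from reg0[OF this] show ?thesis by simp
  qed
  thus ?thesis by (intro that) auto
qed

lemma koszul_of_Var_powers:
  fixes a z :: "3 \<Rightarrow> 'a::comm_ring_1 R"
  assumes a: "\<And>i. Var i ^ N \<in> ideal_span (range a)" and z: "dot a z = 0"
  obtains w where "z = cross a w"
proof (rule depth_sensitivity[of "\<lambda>i. Var i ^ N" a z])
  fix u :: "'a R"
  show "u = 0" if "Var 0 ^ N * u = 0"
    using Var_power_regular[of 0 "{}" N u] that by (simp add: ideal_span_empty)
  show "u \<in> ideal_span {Var 0 ^ N}" if "Var 1 ^ N * u \<in> ideal_span {Var 0 ^ N}"
    using Var_power_regular[of 1 "{0}" N u] that by simp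
  show "u \<in> ideal_span {Var 0 ^ N, Var 1 ^ N}" if "Var 2 ^ N * u \<in> ideal_span {Var 0 ^ N, Var 1 ^ N}"
    using Var_power_regular[of 2 "{0, 1}" N u] that by simp
qed (use a z that in auto)

section \<open>Reductions of ideals primary to the irrelevant ideal\<close>

lemma ideal_power_base: "x \<in> I \<Longrightarrow> x ^ q \<in> ideal_power I q"
  by (induction q) (auto simp: ideal_prod_def intro!: ideal_span_base)

lemma ideal_prod_subset: "is_ideal J \<Longrightarrow> ideal_prod J K \<subseteq> J"
  unfolding ideal_prod_def
  by (rule ideal_span_minimal) (auto simp: mult.commute dest: module.subspace_scale[OF module_times])

lemma reduction_power_mem:
  assumes "reduction J I" shows "\<exists>q. \<forall>x\<in>I. x ^ q \<in> J"
  using assms ideal_prod_subset[of J] ideal_power_base[of _ I] unfolding reduction_def by (metis subsetD)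

text \<open>
  From \<open>I\<^sup>q\<^sup>+\<^sup>1 = J I\<^sup>q \<subseteq> J\<close> it follows that \<open>J\<close> has the same radical as \<open>I\<close>. The exponent is a sum over all
  variables because one exponent has to serve for all of them.
\<close>
lemma Var_powers_in_reduction:
  fixes I J :: "('x::finite, 'a::comm_ring_1) mpoly set"
  assumes "radical I = irrelevant_ideal" and "reduction J I"
  obtains N where "\<And>i. Var i ^ N \<in> J"
proof -
  obtain q where q: "\<And>x. x \<in> I \<Longrightarrow> x ^ q \<in> J" using reduction_power_mem[OF assms(2)] by blast
  have J: "is_ideal J" using assms(2) by (simp add: reduction_def)
  have "\<exists>m. Var i ^ m \<in> I" for i :: 'x
    using assms(1) ideal_span_base[of "Var i" "range Var"]
    by (auto simp: irrelevant_ideal_def radical_def)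
  then obtain m where m: "\<And>i :: 'x. Var i ^ m i \<in> I" by metis
  have "Var i ^ (\<Sum>j\<in>UNIV. m j * q) \<in> J" for i
  proof -
    have "m i * q \<le> (\<Sum>j\<in>UNIV. m j * q)" by (rule member_le_sum) auto
    then obtain r where "(\<Sum>j\<in>UNIV. m j * q) = r + m i * q" by (metis le_Suc_ex add.commute)
    thus ?thesis
      using module.subspace_scale[OF module_times J q[OF m[of i]], of "Var i ^ r"]
      by (simp add: power_add power_mult)
  qed
  thus ?thesis by (rule that)
qed

section \<open>Specialisation at the last variable\<close>

text \<open>
  The value at \<open>T = (0, 0, 0, 1)\<close>. On a form in the \<open>T\<^sub>i\<close> it is the coefficient of the pure power of
  \<open>T\<^sub>4\<close>.
\<close>
definition eval_at_T4 :: "(4, 'a::comm_ring_1) mpoly \<Rightarrow> 'a"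
  where "eval_at_T4 = mpoly_eval id (\<lambda>i. if i = 3 then 1 else 0)"

interpretation eval_at_T4: comm_ring_hom "eval_at_T4 :: (4, 'a::comm_ring_1) mpoly \<Rightarrow> 'a"
  unfolding eval_at_T4_def by (rule comm_ring_hom.comm_ring_hom_mpoly_eval[OF comm_ring_hom_id])

lemma eval_at_T4_simps [simp]:
  "eval_at_T4 (Const c) = c" "eval_at_T4 (Var i) = (if i = 3 then 1 else 0)"
  "eval_at_T4 (syzygy_form c') = c' 3"
  by (simp_all add: eval_at_T4_def comm_ring_hom.mpoly_eval_Const[OF comm_ring_hom_id]
    comm_ring_hom.mpoly_eval_Var[OF comm_ring_hom_id]
    comm_ring_hom.mpoly_eval_syzygy_form[OF comm_ring_hom_id] sum_UNIV_4)

lemma eval_at_T4_map_Const: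
  "eval_at_T4 (Poly_Mapping.map (Const :: 'a::comm_ring_1 \<Rightarrow> ('x, 'a) mpoly) p) =
    Const (eval_at_T4 p)"
proof -
  let ?t = "\<lambda>i::4. if i = 3 then 1 else 0 :: 'a"
  have "Const (mpoly_eval id ?t p) =
      mpoly_eval id (\<lambda>i. Const (?t i)) (Poly_Mapping.map (Const :: 'a \<Rightarrow> ('x, 'a) mpoly) p)"
    by (rule comm_ring_hom.hom_mpoly_eval[OF comm_ring_hom_Const])
  also have "(\<lambda>i. Const (?t i) :: ('x, 'a) mpoly) = (\<lambda>i. if i = 3 then 1 else 0)"
    by (auto simp: Const_simps)
  finally show ?thesis unfolding eval_at_T4_def by (rule sym)
qed

text \<open>
  If the determinant vanishes, so does that of the specialised matrix, which has entries in the field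
  \<open>k\<close>. A vector in its kernel is a linear relation between the specialised forms, because their
  coefficients are the columns of that matrix.
\<close>
lemma content_matrix_kernel:
  fixes B :: "'k::field kT mat" and ms :: "('x::finite \<Rightarrow>\<^sub>0 nat) list"
  assumes B: "is_content_matrix d ms Fs B" and len: "length ms = length Fs" and det: "det B = 0"
  obtains v where "\<exists>j<length Fs. v j \<noteq> 0"
    and "(\<Sum>j<length Fs. Const (v j) * eval_at_T4 (Fs ! j)) = 0"
proof -
  let ?N = "length Fs" and ?B = "map_mat eval_at_T4 B"
  have carrier: "B \<in> carrier_mat ?N ?N"
    and eq: "row_matrix Fs =
      row_matrix (map (\<lambda>\<alpha>. Const (xmonom \<alpha>)) ms) * map_mat (Poly_Mapping.map Const) B"
    using B len by (auto simp: is_content_matrix_def)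
  have F: "Fs ! j = (\<Sum>i<?N. Const (xmonom (ms ! i)) * Poly_Mapping.map Const (B $$ (i, j)))"
    if "j < ?N" for j
  proof -
    have "Fs ! j = row_matrix Fs $$ (0, j)" using that by (simp add: row_matrix_def)
    also have "\<dots> = (\<Sum>i<?N. Const (xmonom (ms ! i)) * Poly_Mapping.map Const (B $$ (i, j)))"
      unfolding eq using carrier that len
      by (auto simp: row_matrix_def scalar_prod_def lessThan_atLeast0 intro!: sum.cong)
    finally show ?thesis .
  qed
  have "det ?B = 0" using det by simp
  then obtain v where v: "v \<in> carrier_vec ?N" "v \<noteq> 0\<^sub>v ?N" "?B *\<^sub>v v = 0\<^sub>v ?N"
    using det_0_iff_vec_prod_zero_field[of ?B ?N] carrier by auto
  have row: "(\<Sum>j<?N. eval_at_T4 (B $$ (i, j)) * v $ j) = 0" if "i < ?N" for i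
  proof -
    have "(?B *\<^sub>v v) $ i = 0" using v(3) that by simp
    thus ?thesis using that carrier v(1) by (auto simp: scalar_prod_def lessThan_atLeast0)
  qed
  interpret Const: comm_ring_hom "Const :: 'k \<Rightarrow> ('x, 'k) mpoly" by (rule comm_ring_hom_Const)
  have "(\<Sum>j<?N. Const (v $ j) * eval_at_T4 (Fs ! j)) =
      (\<Sum>j<?N. \<Sum>i<?N. xmonom (ms ! i) * Const (eval_at_T4 (B $$ (i, j)) * v $ j))"
    by (rule sum.cong)
      (simp_all add: F eval_at_T4.hom_sum eval_at_T4.hom_mult eval_at_T4_map_Const
        sum_distrib_left Const.hom_mult mult_ac)
  also have "\<dots> = (\<Sum>i<?N. xmonom (ms ! i) * Const (\<Sum>j<?N. eval_at_T4 (B $$ (i, j)) * v $ j))"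
    by (subst sum.swap) (simp add: Const.hom_sum sum_distrib_left)
  also have "\<dots> = 0" by (simp add: row)
  finally have "(\<Sum>j<?N. Const (v $ j) * eval_at_T4 (Fs ! j)) = 0" .
  moreover have "\<exists>j<?N. v $ j \<noteq> 0" using v(1,2) by (auto intro: eq_vecI)
  ultimately show ?thesis by (rule that[rotated])
qed

section \<open>Quadratic relations and syzygies of low degree\<close>

text \<open>
  The indices of the generators of \<open>J\<close>, relabelled by the type \<open>3\<close> with its cyclic arithmetic, as
  \<open>cross\<close> requires.
\<close>
definition first3 :: "3 \<Rightarrow> 4"
  where "first3 i = (if i = 0 then 0 else if i = 1 then 1 else 2)"

lemma first3_simps [simp]: "first3 0 = 0" "first3 1 = 1" "first3 2 = 2" "first3 i \<noteq> 3"
  by (simp_all add: first3_def)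

lemma rees_map_hom: "comm_ring_hom (rees_map (g :: 'i::finite \<Rightarrow> 'a::comm_ring_1))"
  unfolding rees_map_eq_eval
  by (rule comm_ring_hom.comm_ring_hom_mpoly_eval[OF comm_ring_hom_const_poly])

lemma rees_map_simps [simp]:
  "rees_map g (Const c) = [:c:]" "rees_map g (Var i) = monom (g i) 1"
  "rees_map g (syzygy_form c') = monom (\<Sum>j\<in>UNIV. c' j * g j) 1"
  by (simp_all add: rees_map_eq_eval comm_ring_hom.mpoly_eval_Const[OF comm_ring_hom_const_poly]
    comm_ring_hom.mpoly_eval_Var[OF comm_ring_hom_const_poly]
    comm_ring_hom.mpoly_eval_syzygy_form[OF comm_ring_hom_const_poly] smult_monom monom_sum)

lemma form_syzygy_form: "form 1 (syzygy_form c)"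
  unfolding syzygy_form_def by (rule form_sum) (use form_mult[OF form_Const form_Var] in simp)

lemma S1L1_generator:
  "form 1 s \<Longrightarrow> form 1 l \<Longrightarrow> rees_map g l = 0 \<Longrightarrow> s * l \<in> S1L1 g"
  unfolding S1L1_def by (rule polymod.span_base) (auto simp: graded_part_def rees_ideal_def)

text \<open>
  Without the term \<open>T\<^sub>4\<^sup>2\<close>, the quadric \<open>G\<close> is a combination \<open>T\<^sub>1 A\<^sub>1 + T\<^sub>2 A\<^sub>2 + T\<^sub>3 A\<^sub>3\<close>. Its vanishing under
  the Rees map makes the values of the linear forms \<open>A\<^sub>i\<close> at \<open>g\<close> a syzygy of the first three elements of
  \<open>g\<close>, hence a cross product \<open>a \<times> w\<close>. Since \<open>T \<cdot> (T \<times> w) = 0\<close>, replacing \<open>A\<close> by \<open>A - T \<times> w\<close>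
  preserves \<open>G\<close> and turns the coefficients of the \<open>T\<^sub>i\<close> into elements of \<open>L\<^sub>1\<close>.
\<close>
lemma quadric_in_S1L1:
  fixes g :: "4 \<Rightarrow> 'a::comm_ring_1" and G :: "(4, 'a) mpoly"
  assumes koszul: "\<And>z. dot (g \<circ> first3) z = 0 \<Longrightarrow> \<exists>w. z = cross (g \<circ> first3) w"
    and G: "form 2 G" "rees_map g G = 0" "eval_at_T4 G = 0"
  shows "G \<in> S1L1 g"
proof -
  interpret rees: comm_ring_hom "rees_map g" by (rule rees_map_hom)
  let ?T = "Var \<circ> first3 :: 3 \<Rightarrow> (4, 'a) mpoly" and ?a = "g \<circ> first3"
  have "form (Suc 1) G" using G(1) by (simp add: numeral_2_eq_2)
  then obtain A where A: "\<And>i. form 1 (A i)" "G = (\<Sum>i\<in>UNIV. Var i * A i)"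
    by (rule form_Suc_decomp) blast
  obtain \<alpha> where \<alpha>: "A 3 = syzygy_form \<alpha>" using form_1_eq_syzygy_form[OF A(1)] .
  \<comment> \<open>The mixed terms of \<open>T\<^sub>4 A\<^sub>4\<close> are shared out among the other three summands.\<close>
  define A' where "A' i = A (first3 i) + Const (\<alpha> (first3 i)) * Var 3" for i
  have "G = dot ?T A' + Const (\<alpha> 3) * Var 3 * Var 3"
    unfolding A(2) by (simp add: sum_UNIV_4 \<alpha> syzygy_form_def dot_def A'_def algebra_simps)
  moreover from this have "\<alpha> 3 = 0"
    using G(3) by (simp add: dot_def eval_at_T4.hom_add eval_at_T4.hom_mult)
  ultimately have GT: "G = dot ?T A'" by (simp add: Const_simps)
  have A'1: "form 1 (A' i)" for i
    unfolding A'_def using form_mult[OF form_Const form_Var] by (intro form_add A(1)) simp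
  have "\<exists>\<beta>. A' i = syzygy_form \<beta>" for i using form_1_eq_syzygy_form[OF A'1] by blast
  then obtain \<beta> where \<beta>: "\<And>i. A' i = syzygy_form (\<beta> i)" by metis
  define z where "z i = (\<Sum>j\<in>UNIV. \<beta> i j * g j)" for i
  have \<rho>A': "rees_map g (A' i) = monom (z i) 1" for i by (simp add: \<beta> z_def)
  have "monom (dot ?a z) 2 = rees_map g G"
    unfolding GT by (simp add: dot_def rees.hom_add rees.hom_mult \<rho>A' mult_monom add_monom numeral_2_eq_2)
  hence "dot ?a z = 0" using G(2) by simp
  then obtain w where w: "z = cross ?a w" using koszul by blast
  define l where "l i = A' i - cross ?T (\<lambda>j. Const (w j)) i" for i
  have "form 1 (?T i * Const c)" for i c
    using form_mult[OF form_Var form_Const] by simp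
  hence l1: "form 1 (l i)" for i
    unfolding l_def cross_def by (intro form_diff A'1)
  have l0: "rees_map g (l i) = 0" for i
    unfolding l_def
    by (simp add: cross_def rees.hom_minus rees.hom_mult \<rho>A' w smult_monom diff_monom mult.commute)
  have "G = dot ?T l"
    using GT dot_cross_self[of ?T "\<lambda>j. Const (w j)"] by (simp add: l_def dot_def algebra_simps)
  moreover have "?T i * l i \<in> S1L1 g" for i
    using S1L1_generator[OF form_Var l1 l0] by simp
  ultimately show ?thesis
    unfolding dot_def S1L1_def by (simp only: polymod.span_add)
qed

text \<open>
  With last entry zero, \<open>c\<close> is a Koszul syzygy of the first three elements of \<open>g\<close>. Its entries lie in the
  ideal generated by these forms of degree \<open>n\<close> and contain no monomials of smaller degree.
\<close>
lemma low_degree_syzygy_eq_0: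
  fixes g c :: "4 \<Rightarrow> 'a::comm_ring_1 R"
  assumes koszul: "\<And>z. dot (g \<circ> first3) z = 0 \<Longrightarrow> \<exists>w. z = cross (g \<circ> first3) w"
    and g: "\<And>i. form n (g i)" and "d < n"
    and c: "c \<in> Syz g" "\<And>i. form d (c i)" "c 3 = 0"
  shows "c = 0"
proof -
  have "dot (g \<circ> first3) (c \<circ> first3) = 0"
    using c(1,3) by (simp add: Syz_def sum_UNIV_4 dot_def algebra_simps)
  then obtain w where w: "c \<circ> first3 = cross (g \<circ> first3) w" using koszul by blast
  have cross_i: "(c \<circ> first3) i = g (first3 (i + 1)) * w (i + 2) - g (first3 (i + 2)) * w (i + 1)" for i
    unfolding w by (simp add: cross_def)
  have large: "n \<le> mdeg \<beta>" if "\<beta> \<in> Poly_Mapping.keys (g j * p)" for \<beta> j p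
    using keys_mult[of "g j" p] that g[of j] by (force simp: form_def)
  have "(c \<circ> first3) i = 0" for i
  proof (rule ccontr)
    assume "(c \<circ> first3) i \<noteq> 0"
    then obtain \<beta> where \<beta>: "\<beta> \<in> Poly_Mapping.keys ((c \<circ> first3) i)"
      by (metis all_not_in_conv keys_eq_empty)
    hence "mdeg \<beta> = d" using c(2) by (auto simp: form_def)
    moreover have "n \<le> mdeg \<beta>"
      using \<beta> unfolding cross_i
      using keys_diff[of "g (first3 (i + 1)) * w (i + 2)" "g (first3 (i + 2)) * w (i + 1)"] large
      by blast
    ultimately show False using \<open>d < n\<close> by simp
  qed
  from this[of 0] this[of 1] this[of 2] have "\<forall>i\<in>UNIV. c i = 0"
    unfolding UNIV_4 using c(3) by simp
  thus ?thesis by (simp add: fun_eq_iff)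
qed

section \<open>The determinant of the content matrix\<close>

theorem theorem4p1:
  fixes n :: nat
    and g :: "4 \<Rightarrow> 'k::field R"
    and I J :: "'k R set"
    and cs :: "(4 \<Rightarrow> 'k R) list"
    and hs :: "'k S list"
    and ms :: "(3 \<Rightarrow>\<^sub>0 nat) list"
    and B :: "'k kT mat"
  assumes "2 \<le> n" and "n \<le> 7"
    and "\<And>i. form n (g i)"
    and "minimal_generators g I"
    and "primary_ideal I" and "radical I = irrelevant_ideal"
    and "J = ideal_span {g 0, g 1, g 2}"
    and "minimal_reduction J I"
    and "balanced (n - 1) g"
    and "is_kbasis cs {c \<in> Syz g. \<forall>i. form (n - 1) (c i)}"
    and "length cs = n"
    and "\<And>h \<beta>. h \<in> set hs \<Longrightarrow> form (n - 1) (Poly_Mapping.lookup h \<beta>)"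
    and "\<And>h. h \<in> set hs \<Longrightarrow> h \<in> graded_part (rees_ideal g) 2"
    and "minimally_generates_quotient hs (graded_part (rees_ideal g) 2) (S1L1 g)"
    and "length hs = n choose 2"
    and "is_content_matrix (n - 1) ms (map syzygy_form cs @ hs) B"
  shows "det B \<noteq> 0"
proof
  assume det: "det B = 0"
  let ?Fs = "map syzygy_form cs @ hs" and ?L2 = "graded_part (rees_ideal g) 2"
  let ?V = "{c \<in> Syz g. \<forall>i. form (n - 1) (c i)}"
  let ?N = "length ?Fs"
  have koszul: "\<exists>w. z = cross (g \<circ> first3) w" if z: "dot (g \<circ> first3) z = 0" for z
  proof -
    have "reduction J I" using assms(8) by (simp add: minimal_reduction_def)
    then obtain N where "\<And>i. Var i ^ N \<in> J" by (rule Var_powers_in_reduction[OF assms(6)]) blast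
    moreover have "J = ideal_span (range (g \<circ> first3))"
      using assms(7) by (simp add: UNIV_3)
    ultimately show ?thesis using koszul_of_Var_powers[OF _ z] by metis
  qed
  have "length ms = card {\<alpha> :: 3 \<Rightarrow>\<^sub>0 nat. mdeg \<alpha> = n - 1}"
    using assms(16) by (metis is_content_matrix_def distinct_card)
  also have "\<dots> = ?N"
    using assms(1,11,15) unfolding card_exponents_3 by (cases n) (simp_all add: numeral_2_eq_2)
  finally obtain v where v: "\<exists>j<?N. v j \<noteq> 0"
    and rel: "(\<Sum>j<?N. Const (v j) * eval_at_T4 (?Fs ! j)) = 0"
    using content_matrix_kernel[OF assms(16) _ det] by blast
  have L2: "polymod.span (set hs \<union> S1L1 g) = ?L2"
    and hs: "distinct hs" "\<And>h. h \<in> set hs \<Longrightarrow> h \<notin> polymod.span ((set hs - {h}) \<union> S1L1 g)"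
    using assms(14) by (auto simp: minimally_generates_quotient_def)
  have cs: "distinct cs" "kvs.independent (set cs)" "kvs.span (set cs) = ?V"
    using assms(10) by (auto simp: is_kbasis_def)
  \<comment> \<open>The factor \<open>T\<^sub>4\<close> lifts the syzygy forms to degree 2 and takes the value 1 at \<open>(0, 0, 0, 1)\<close>.\<close>
  define x where "x j = (if j < n then Var 3 * ?Fs ! j else ?Fs ! j)" for j
  have x_f: "x j \<in> S1L1 g" if "j < n" for j
  proof -
    have "cs ! j \<in> kvs.span (set cs)" using that assms(11) by (intro kvs.span_base) auto
    hence "rees_map g (syzygy_form (cs ! j)) = 0" unfolding cs(3) by (simp add: Syz_def)
    hence "Var 3 * syzygy_form (cs ! j) \<in> S1L1 g"
      by (intro S1L1_generator form_Var form_syzygy_form)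
    thus ?thesis using that assms(11) by (simp add: x_def nth_append)
  qed
  have x_h: "x j = hs ! (j - n)" if "n \<le> j" for j
    using that assms(11) by (simp add: x_def nth_append)
  define G where "G = (\<Sum>j<?N. scaleC (Const (v j)) (x j))"
  have "x j \<in> ?L2" if "j < ?N" for j
    unfolding L2[symmetric] using x_f[of j] x_h[of j] that assms(11)
    by (cases "j < n") (auto intro!: polymod.span_base)
  hence "G \<in> ?L2"
    unfolding G_def L2[symmetric] by (intro polymod.span_sum polymod.span_scale) auto
  moreover have "eval_at_T4 G = (\<Sum>j<?N. Const (v j) * eval_at_T4 (?Fs ! j))"
    unfolding G_def eval_at_T4.hom_sum
    by (intro sum.cong) (simp_all add: scaleC_def eval_at_T4.hom_mult x_def)
  ultimately have G: "G \<in> S1L1 g"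
    using rel by (intro quadric_in_S1L1 koszul) (auto simp: graded_part_def rees_ideal_def)
  \<comment> \<open>Otherwise \<open>G\<close> would express one of the generators of \<open>L\<^sub>2\<close> modulo \<open>S\<^sub>1L\<^sub>1\<close> by the others.\<close>
  have v_h: "v j = 0" if j: "n \<le> j" "j < ?N" for j
  proof (rule ccontr)
    assume "v j \<noteq> 0"
    let ?h = "hs ! (j - n)"
    have h: "?h \<in> set hs" using j assms(11) by auto
    have "x j \<in> polymod.span ((set hs - {?h}) \<union> S1L1 g)"
    proof (rule polymod.unit_coefficient_in_span[where J = "{..<?N}" and r = "\<lambda>j. Const (v j)"])
      show "Const (inverse (v j)) * Const (v j) = 1"
        using \<open>v j \<noteq> 0\<close> by (simp flip: Const_simps(4) add: Const_simps(2))
      show "(\<Sum>j<?N. scaleC (Const (v j)) (x j)) \<in> polymod.span ((set hs - {?h}) \<union> S1L1 g)"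
        using G by (auto simp: G_def intro: polymod.span_base)
      fix i assume i: "i \<in> {..<?N}" "i \<noteq> j"
      show "x i \<in> polymod.span ((set hs - {?h}) \<union> S1L1 g)"
      proof (cases "i < n")
        case False
        hence "hs ! (i - n) \<in> set hs - {?h}"
          using i j hs(1) assms(11) by (auto simp: nth_eq_iff_index_eq)
        thus ?thesis using x_h[of i] False by (auto intro: polymod.span_base)
      qed (auto intro: polymod.span_base x_f)
    qed (use j in auto)
    thus False using hs(2)[OF h] x_h[OF j(1)] by simp
  qed
  \<comment> \<open>By the surviving part of the relation, this syzygy has last entry 0.\<close>
  define c where "c = (\<Sum>j<n. scaleK (v j) (cs ! j))"
  have "c \<in> ?V"
    unfolding c_def cs(3)[symmetric]
    using assms(11) by (intro kvs.span_sum kvs.span_scale kvs.span_base) auto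
  moreover have "c 3 = 0"
  proof -
    have "c 3 = (\<Sum>j<n. Const (v j) * (cs ! j) 3)"
      unfolding c_def by (induction n) (simp_all add: scaleK_def)
    also have "\<dots> = (\<Sum>j<n. Const (v j) * eval_at_T4 (?Fs ! j))"
      using assms(11) by (intro sum.cong) (simp_all add: nth_append)
    also have "\<dots> = (\<Sum>j<?N. Const (v j) * eval_at_T4 (?Fs ! j))"
      using assms(11) v_h by (intro sum.mono_neutral_left) (auto simp: Const_simps not_less)
    finally show ?thesis using rel by simp
  qed
  ultimately have "c = 0"
    using low_degree_syzygy_eq_0[OF koszul assms(3), of "n - 1" c] assms(1) by simp
  have v_f: "v j = 0" if j: "j < n" for j
  proof (rule ccontr)
    assume "v j \<noteq> 0"
    have "cs ! j \<in> kvs.span (set cs - {cs ! j})"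
    proof (rule kvs.unit_coefficient_in_span[where J = "{..<n}" and r = v])
      show "inverse (v j) * v j = 1" using \<open>v j \<noteq> 0\<close> by simp
      show "(\<Sum>j<n. scaleK (v j) (cs ! j)) \<in> kvs.span (set cs - {cs ! j})"
        using \<open>c = 0\<close> kvs.span_zero by (simp add: c_def)
      fix i assume "i \<in> {..<n}" "i \<noteq> j"
      thus "cs ! i \<in> kvs.span (set cs - {cs ! j})"
        using j cs(1) assms(11) by (intro kvs.span_base) (auto simp: nth_eq_iff_index_eq)
    qed (use j in auto)
    thus False using cs(2) j assms(11) by (auto simp: kvs.dependent_def)
  qed
  show False using v v_f v_h by (meson not_less)
qed

end
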